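(* The space $\mathcal{EH}_1^{<\omega}$ of isometry classes of finite subsets of the real line, endowed with the Euclidean-Hausdorff distance, cannot be coarsely embedded into any uniformly convex Banach space.
   Context: Finite subsets of $\mathbb{R}$ are taken nonempty and regarded as metric spaces with the inherited metric. For $X,Y\subseteq\mathbb{R}$ the Hausdorff distance is $d_H(X,Y)=\inf_{\mathcal{R}}\sup_{(x,y)\in\mathcal{R}}|x-y|$, over correspondences $\mathcal{R}\subseteq X\times Y$ (relations in which every $x\in X$ is related to at least one $y\in Y$ and vice versa). The Euclidean-Hausdorff distance is $d_{EH}(X,Y)=\inf\{d_H(i_X(X),i_Y(Y))\mid i_X\colon X\to\mathbb{R},\ i_Y\colon Y\to\mathbb{R}\text{ isometric embeddings}\}$, equivalently $\inf_{f\in\operatorname{Isom}(\mathbb{R})}d_H(X,f(Y))$. It is a metric on isometry classes of finite subsets of $\mathbb{R}$. A map $\psi\colon(X,d_X)\to(Y,d_Y)$ between metric spaces is a coarse embedding if there are maps $\rho_-,\rho_+\colon\mathbb{R}_{\ge0}\to\mathbb{R}_{\ge0}$ with $\rho_-(t)\to\infty$ as $t\to\infty$ such that $\rho_-(d_X(x,y))\le d_Y(\psi(x),\psi(y))\le\rho_+(d_X(x,y))$ for all $x,y\in X$. A Banach space $(A,\|\cdot\|)$ is uniformly convex if for every $0<\varepsilon\le2$ there is $\delta>0$ such that for all $x,y\in A$ with $\|x\|=\|y\|=1$, $\|x-y\|\ge\varepsilon$ implies $\|(x+y)/2\|\le1-\delta$. *)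

theory Defs
  imports "HOL-Analysis.Analysis"
begin

section \<open>Hausdorff and Euclidean-Hausdorff distance\<close>

definition correspondence :: "'a set \<Rightarrow> 'b set \<Rightarrow> ('a \<times> 'b) set \<Rightarrow> bool" where
  "correspondence X Y R \<longleftrightarrow>
     R \<subseteq> X \<times> Y \<and> (\<forall>x\<in>X. \<exists>y\<in>Y. (x, y) \<in> R) \<and> (\<forall>y\<in>Y. \<exists>x\<in>X. (x, y) \<in> R)"

text \<open>The infimum and the suprema are taken in \<^typ>\<open>real\<close>; they are the intended ones when
  \<open>X\<close> and \<open>Y\<close> are finite and nonempty, the only case in which the definition is used.\<close>

definition hausdorff_dist :: "real set \<Rightarrow> real set \<Rightarrow> real" where
  "hausdorff_dist X Y = (INF R \<in> {R. correspondence X Y R}. SUP (x, y) \<in> R. \<bar>x - y\<bar>)"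

definition isometric_embedding_on :: "'a::metric_space set \<Rightarrow> ('a \<Rightarrow> 'b::metric_space) \<Rightarrow> bool" where
  "isometric_embedding_on X f \<longleftrightarrow> (\<forall>x\<in>X. \<forall>y\<in>X. dist (f x) (f y) = dist x y)"

definition isometric :: "'a::metric_space set \<Rightarrow> 'b::metric_space set \<Rightarrow> bool" where
  "isometric X Y \<longleftrightarrow> (\<exists>f. isometric_embedding_on X f \<and> f ` X = Y)"

definition eh_dist :: "real set \<Rightarrow> real set \<Rightarrow> real" where
  "eh_dist X Y = Inf {hausdorff_dist (i ` X) (j ` Y) | i j.
      isometric_embedding_on X (i :: real \<Rightarrow> real) \<and> isometric_embedding_on Y (j :: real \<Rightarrow> real)}"

lemma hausdorff_dist_less_iff:
  assumes "finite X" "X \<noteq> {}" "finite Y" "Y \<noteq> {}"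
  shows "hausdorff_dist X Y < e \<longleftrightarrow>
    (\<exists>R. correspondence X Y R \<and> (\<forall>(x, y)\<in>R. \<bar>x - y\<bar> < e))"
proof -
  let ?S = "\<lambda>R. (SUP (x, y) \<in> R. \<bar>x - y\<bar> :: real)"
  have fin: "finite R" "R \<noteq> {}" if "correspondence X Y R" for R
    using that assms finite_subset[of R "X \<times> Y"] unfolding correspondence_def by auto
  have S: "?S R < e \<longleftrightarrow> (\<forall>(x, y)\<in>R. \<bar>x - y\<bar> < e)" if "correspondence X Y R" for R
    using fin[OF that] by (subst cSup_eq_Max) (auto simp: Max_less_iff)
  have ne: "{R. correspondence X Y R} \<noteq> {}"
    using assms by (auto simp: correspondence_def intro!: exI[of _ "X \<times> Y"])
  have nonneg: "0 \<le> ?S R" if R: "correspondence X Y R" for R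
  proof -
    obtain p where p: "p \<in> R" using fin(2)[OF R] by blast
    have "(case p of (x, y) \<Rightarrow> \<bar>x - y\<bar>) \<le> ?S R"
      using fin(1)[OF R] p by (intro cSUP_upper) auto
    then show ?thesis by (cases p) auto
  qed
  have bdd: "bdd_below (?S ` {R. correspondence X Y R})"
    using nonneg by (intro bdd_belowI[of _ 0]) auto
  show ?thesis
    unfolding hausdorff_dist_def by (subst cINF_less_iff[OF ne bdd]) (use S in blast)
qed

lemma hausdorff_dist_nonneg:
  assumes "finite X" "X \<noteq> {}" "finite Y" "Y \<noteq> {}"
  shows "0 \<le> hausdorff_dist X Y"
proof (rule ccontr)
  assume "\<not> 0 \<le> hausdorff_dist X Y"
  then obtain R where R: "correspondence X Y R" "\<forall>(x, y)\<in>R. \<bar>x - y\<bar> < 0"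
    using hausdorff_dist_less_iff[OF assms, of 0] by auto
  then show False using assms(2) unfolding correspondence_def by fastforce
qed

lemma eh_dist_nonneg:
  assumes "finite X" "X \<noteq> {}" "finite Y" "Y \<noteq> {}"
  shows "0 \<le> eh_dist X Y"
  unfolding eh_dist_def
proof (rule cInf_greatest)
  show "{hausdorff_dist (i ` X) (j ` Y) | i j.
      isometric_embedding_on X (i :: real \<Rightarrow> real) \<and> isometric_embedding_on Y (j :: real \<Rightarrow> real)} \<noteq> {}"
    by (auto intro!: exI[of _ "\<lambda>x. x"] simp: isometric_embedding_on_def)
qed (use assms in \<open>auto intro!: hausdorff_dist_nonneg\<close>)

lemma eh_dist_less_iff:
  assumes "finite X" "X \<noteq> {}" "finite Y" "Y \<noteq> {}"
  shows "eh_dist X Y < e \<longleftrightarrow>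
    (\<exists>(i :: real \<Rightarrow> real) (j :: real \<Rightarrow> real) R.
       isometric_embedding_on X i \<and> isometric_embedding_on Y j \<and>
       correspondence X Y R \<and> (\<forall>(x, y)\<in>R. \<bar>i x - j y\<bar> < e))"
proof -
  let ?D = "{hausdorff_dist (i ` X) (j ` Y) | i j.
      isometric_embedding_on X (i :: real \<Rightarrow> real) \<and> isometric_embedding_on Y (j :: real \<Rightarrow> real)}"
  have ne: "?D \<noteq> {}"
    by (auto intro!: exI[of _ "\<lambda>x. x"] simp: isometric_embedding_on_def)
  have bdd: "bdd_below ?D"
    using assms by (intro bdd_belowI[of _ 0]) (auto intro!: hausdorff_dist_nonneg)
  have H: "hausdorff_dist (i ` X) (j ` Y) < e \<longleftrightarrow>
      (\<exists>R. correspondence X Y R \<and> (\<forall>(x, y)\<in>R. \<bar>i x - j y\<bar> < e))" for i j :: "real \<Rightarrow> real"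
  proof -
    have "hausdorff_dist (i ` X) (j ` Y) < e \<longleftrightarrow>
      (\<exists>R. correspondence (i ` X) (j ` Y) R \<and> (\<forall>(x, y)\<in>R. \<bar>x - y\<bar> < e))"
      using assms by (intro hausdorff_dist_less_iff) auto
    also have "\<dots> \<longleftrightarrow> (\<exists>R. correspondence X Y R \<and> (\<forall>(x, y)\<in>R. \<bar>i x - j y\<bar> < e))"
    proof (intro iffI; elim exE conjE)
      fix R assume "correspondence (i ` X) (j ` Y) R" "\<forall>(x, y)\<in>R. \<bar>x - y\<bar> < e"
      then show "\<exists>R. correspondence X Y R \<and> (\<forall>(x, y)\<in>R. \<bar>i x - j y\<bar> < e)"
        by (intro exI[of _ "{(x, y) \<in> X \<times> Y. (i x, j y) \<in> R}"])
           (auto simp: correspondence_def)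
    next
      fix R assume R: "correspondence X Y R" "\<forall>(x, y)\<in>R. \<bar>i x - j y\<bar> < e"
      have "correspondence (i ` X) (j ` Y) ((\<lambda>(x, y). (i x, j y)) ` R)"
        using R(1) unfolding correspondence_def by (fastforce simp: image_iff)
      then show "\<exists>R. correspondence (i ` X) (j ` Y) R \<and> (\<forall>(x, y)\<in>R. \<bar>x - y\<bar> < e)"
        using R(2) by (intro exI[of _ "(\<lambda>(x, y). (i x, j y)) ` R"]) auto
    qed
    finally show ?thesis .
  qed
  show ?thesis
    unfolding eh_dist_def by (subst cInf_less_iff[OF ne bdd]) (use H in blast)
qed

lemma isometric_refl: "isometric X X"
  unfolding isometric_def isometric_embedding_on_def by (intro exI[of _ "\<lambda>x. x"]) auto

lemma isometric_sym:
  assumes "isometric X Y" shows "isometric Y X"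
proof -
  obtain f where f: "isometric_embedding_on X f" "f ` X = Y"
    using assms unfolding isometric_def by blast
  have "inj_on f X"
    using f(1) unfolding isometric_embedding_on_def inj_on_def by (metis dist_eq_0_iff)
  then show ?thesis
    using f unfolding isometric_def isometric_embedding_on_def
    by (intro exI[of _ "inv_into X f"]) (auto simp: image_iff)
qed

lemma isometric_trans:
  assumes "isometric X Y" "isometric Y Z" shows "isometric X Z"
proof -
  obtain f g where "isometric_embedding_on X f" "f ` X = Y" "isometric_embedding_on Y g" "g ` Y = Z"
    using assms unfolding isometric_def by blast
  then show ?thesis
    unfolding isometric_def isometric_embedding_on_def by (intro exI[of _ "g \<circ> f"]) auto
qed

lemma correspondence_converse: "correspondence X Y R \<Longrightarrow> correspondence Y X (R\<inverse>)"
  unfolding correspondence_def by blast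

lemma eh_dist_commute:
  assumes "finite X" "X \<noteq> {}" "finite Y" "Y \<noteq> {}"
  shows "eh_dist X Y = eh_dist Y X"
proof -
  have *: "eh_dist Y X < e" if XY: "eh_dist X Y < e" "finite X" "X \<noteq> {}" "finite Y" "Y \<noteq> {}" for X Y e
  proof -
    obtain i j R where "isometric_embedding_on X (i :: real \<Rightarrow> real)"
      "isometric_embedding_on Y (j :: real \<Rightarrow> real)" "correspondence X Y R"
      "\<forall>(x, y)\<in>R. \<bar>i x - j y\<bar> < e"
      using XY eh_dist_less_iff[of X Y e] by blast
    then show ?thesis
      unfolding eh_dist_less_iff[OF XY(4,5,2,3)]
      by (intro exI[of _ j] exI[of _ i] exI[of _ "R\<inverse>"])
         (auto intro: correspondence_converse simp: abs_minus_commute)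
  qed
  show ?thesis
    using *[of X Y] *[of Y X] assms by (meson linorder_neqE order_less_irrefl)
qed

lemma isometric_embedding_on_real_affine:
  assumes "isometric_embedding_on W (h :: real \<Rightarrow> real)"
  shows "\<exists>s c. (s = 1 \<or> s = -1) \<and> (\<forall>w\<in>W. h w = s * w + c)"
proof (cases "\<exists>a\<in>W. \<exists>b\<in>W. a \<noteq> b")
  case True
  then obtain a b where ab: "a \<in> W" "b \<in> W" "a \<noteq> b" by blast
  have d: "\<bar>h x - h y\<bar> = \<bar>x - y\<bar>" if "x \<in> W" "y \<in> W" for x y
    using assms that unfolding isometric_embedding_on_def dist_real_def by blast
  consider "h b - h a = b - a" | "h b - h a = -(b - a)" using d[OF ab(2,1)] by linarith
  then show ?thesis
  proof cases
    case 1
    have "h w = 1 * w + (h a - a)" if "w \<in> W" for w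
      using d[OF that ab(1)] d[OF that ab(2)] 1 ab(3) by (auto simp: abs_if split: if_splits)
    then show ?thesis by blast
  next
    case 2
    have "h w = -1 * w + (h a + a)" if "w \<in> W" for w
      using d[OF that ab(1)] d[OF that ab(2)] 2 ab(3) by (auto simp: abs_if split: if_splits)
    then show ?thesis by blast
  qed
next
  case False
  show ?thesis
  proof (cases "W = {}")
    case True then show ?thesis by auto
  next
    case False
    then obtain a where "a \<in> W" by blast
    then have "\<forall>w\<in>W. h w = 1 * w + (h a - a)" using \<open>\<not> (\<exists>a\<in>W. \<exists>b\<in>W. a \<noteq> b)\<close> by auto
    then show ?thesis by blast
  qed
qed

lemma isometric_embeddings_on_real_extend:
  assumes "isometric_embedding_on W (h :: real \<Rightarrow> real)" "isometric_embedding_on W (k :: real \<Rightarrow> real)"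
  shows "\<exists>g. (\<forall>x y. \<bar>g x - g y\<bar> = \<bar>x - y :: real\<bar>) \<and> (\<forall>w\<in>W. g (k w) = h w)"
proof -
  obtain s c where h: "s = 1 \<or> s = -1" "\<forall>w\<in>W. h w = s * w + c"
    using isometric_embedding_on_real_affine[OF assms(1)] by blast
  obtain t d where k: "t = 1 \<or> t = -1" "\<forall>w\<in>W. k w = t * w + d"
    using isometric_embedding_on_real_affine[OF assms(2)] by blast
  show ?thesis
    using h k by (intro exI[of _ "\<lambda>x. s * t * (x - d) + c"]) auto
qed

lemma eh_dist_triangle:
  assumes X: "finite X" "X \<noteq> {}" and Y: "finite Y" "Y \<noteq> {}" and Z: "finite Z" "Z \<noteq> {}"
  shows "eh_dist X Z \<le> eh_dist X Y + eh_dist Y Z"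
proof (rule field_le_epsilon)
  fix e :: real assume e: "0 < e"
  let ?a = "eh_dist X Y + e / 2" and ?b = "eh_dist Y Z + e / 2"
  have "eh_dist X Y < ?a" "eh_dist Y Z < ?b" using e by auto
  then obtain i j R k l S where
    i: "isometric_embedding_on X (i :: real \<Rightarrow> real)" and
    j: "isometric_embedding_on Y (j :: real \<Rightarrow> real)" and
    R: "correspondence X Y R" "\<forall>(x, y)\<in>R. \<bar>i x - j y\<bar> < ?a" and
    k: "isometric_embedding_on Y (k :: real \<Rightarrow> real)" and
    l: "isometric_embedding_on Z (l :: real \<Rightarrow> real)" and
    S: "correspondence Y Z S" "\<forall>(y, z)\<in>S. \<bar>k y - l z\<bar> < ?b"
    unfolding eh_dist_less_iff[OF X Y] eh_dist_less_iff[OF Y Z] by blast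
  obtain g where g: "\<And>x y. \<bar>g x - g y\<bar> = \<bar>x - y :: real\<bar>" "\<And>y. y \<in> Y \<Longrightarrow> g (k y) = j y"
    using isometric_embeddings_on_real_extend[OF j k] by blast
  have gl: "isometric_embedding_on Z (g \<circ> l)"
    using l g(1) unfolding isometric_embedding_on_def dist_real_def by auto
  have C: "correspondence X Z (R O S)"
    using R(1) S(1) unfolding correspondence_def by (auto simp: relcomp_unfold) blast+
  have "\<bar>i x - (g \<circ> l) z\<bar> < ?a + ?b" if xz: "(x, z) \<in> R O S" for x z
  proof -
    obtain y where y: "(x, y) \<in> R" "(y, z) \<in> S" using xz by blast
    then have "y \<in> Y" using R(1) unfolding correspondence_def by blast
    then have "\<bar>j y - g (l z)\<bar> < ?b" using S(2) y(2) g by (metis case_prodD)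
    moreover have "\<bar>i x - j y\<bar> < ?a" using R(2) y(1) by blast
    ultimately show ?thesis by simp
  qed
  then have "eh_dist X Z < ?a + ?b"
    unfolding eh_dist_less_iff[OF X Z] using i gl C by blast
  then show "eh_dist X Z \<le> eh_dist X Y + eh_dist Y Z + e" by simp
qed

lemma eh_dist_eq_0_iff:
  assumes X: "finite X" "X \<noteq> {}" and Y: "finite Y" "Y \<noteq> {}"
  shows "eh_dist X Y = 0 \<longleftrightarrow> isometric X Y"
proof
  assume "isometric X Y"
  then obtain f where f: "isometric_embedding_on X f" "f ` X = Y"
    unfolding isometric_def by blast
  have "eh_dist X Y < e" if "e > 0" for e
    unfolding eh_dist_less_iff[OF X Y]
    by (intro exI[of _ f] exI[of _ "\<lambda>x. x"] exI[of _ "{(x, f x) | x. x \<in> X}"])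
       (use f that in \<open>auto simp: correspondence_def isometric_embedding_on_def\<close>)
  then have "eh_dist X Y \<le> 0" by (meson not_le order_less_irrefl)
  then show "eh_dist X Y = 0" using eh_dist_nonneg[OF assms] by simp
next
  assume 0: "eh_dist X Y = 0"
  define D where "D = (\<lambda>(((x, x'), y), y'). \<bar>\<bar>x - x'\<bar> - \<bar>y - y'\<bar>\<bar>) ` (((X \<times> X) \<times> Y) \<times> Y) - {0}"
  have D: "finite D" "\<And>d. d \<in> D \<Longrightarrow> d > 0"
    using X Y unfolding D_def by auto
  obtain e where e: "e > 0" "\<And>d. d \<in> D \<Longrightarrow> 2 * e \<le> d"
  proof (cases "D = {}")
    case True then show ?thesis using that[of 1] by simp
  next
    case False
    then have "Min D > 0" "\<And>d. d \<in> D \<Longrightarrow> Min D \<le> d" using D by auto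
    then show ?thesis using that[of "Min D / 2"] by auto
  qed
  obtain i j R where
    i: "isometric_embedding_on X (i :: real \<Rightarrow> real)" and
    j: "isometric_embedding_on Y (j :: real \<Rightarrow> real)" and
    R: "correspondence X Y R" "\<forall>(x, y)\<in>R. \<bar>i x - j y\<bar> < e"
    using 0 e(1) eh_dist_less_iff[OF assms, of e] by auto
  have eq: "\<bar>x - x'\<bar> = \<bar>y - y'\<bar>" if xy: "(x, y) \<in> R" "(x', y') \<in> R" for x y x' y'
  proof (rule ccontr)
    assume neq: "\<bar>x - x'\<bar> \<noteq> \<bar>y - y'\<bar>"
    have mem: "x \<in> X" "x' \<in> X" "y \<in> Y" "y' \<in> Y" using xy R(1) unfolding correspondence_def by auto
    have "\<bar>\<bar>x - x'\<bar> - \<bar>y - y'\<bar>\<bar> \<in> D" using mem neq unfolding D_def by force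
    then have "2 * e \<le> \<bar>\<bar>x - x'\<bar> - \<bar>y - y'\<bar>\<bar>" using e(2) by blast
    moreover have "\<bar>i x - i x'\<bar> = \<bar>x - x'\<bar>" "\<bar>j y - j y'\<bar> = \<bar>y - y'\<bar>"
      using i j mem unfolding isometric_embedding_on_def dist_real_def by auto
    moreover have "\<bar>i x - j y\<bar> < e" "\<bar>i x' - j y'\<bar> < e" using R(2) xy by auto
    ultimately show False by linarith
  qed
  obtain f where f: "\<And>x. x \<in> X \<Longrightarrow> (x, f x) \<in> R"
    using R(1) unfolding correspondence_def by metis
  have "isometric_embedding_on X f"
    unfolding isometric_embedding_on_def dist_real_def using eq f by metis
  moreover have "f ` X = Y"
  proof (intro equalityI subsetI)
    fix y assume "y \<in> Y"
    then obtain x where x: "x \<in> X" "(x, y) \<in> R" using R(1) unfolding correspondence_def by blast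
    then have "f x = y" using eq[OF x(2) f[OF x(1)]] by simp
    then show "y \<in> f ` X" using x by blast
  qed (use f R(1) in \<open>auto simp: correspondence_def\<close>)
  ultimately show "isometric X Y" unfolding isometric_def by blast
qed

lemma eh_dist_cong_isometric:
  assumes "finite X" "X \<noteq> {}" "finite X'" "X' \<noteq> {}" "finite Y" "Y \<noteq> {}" "finite Y'" "Y' \<noteq> {}"
    and "isometric X X'" "isometric Y Y'"
  shows "eh_dist X Y = eh_dist X' Y'"
proof -
  have "eh_dist X X' = 0" "eh_dist X' X = 0" "eh_dist Y Y' = 0" "eh_dist Y' Y = 0"
    using assms by (simp_all add: eh_dist_eq_0_iff isometric_sym)
  then show ?thesis
    using eh_dist_triangle[of X X' Y] eh_dist_triangle[of X' Y' Y]
      eh_dist_triangle[of X' X Y'] eh_dist_triangle[of X Y Y'] assms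
    by linarith
qed

section \<open>The metric space of isometry classes of finite subsets of the line\<close>

definition fin_isometric :: "real set \<Rightarrow> real set \<Rightarrow> bool" where
  "fin_isometric X Y \<longleftrightarrow> finite X \<and> X \<noteq> {} \<and> finite Y \<and> Y \<noteq> {} \<and> isometric X Y"

quotient_type eh1 = "real set" / partial: fin_isometric
proof (rule part_equivpI)
  show "\<exists>X. fin_isometric X X"
    by (rule exI[of _ "{0}"]) (simp add: fin_isometric_def isometric_refl)
  show "symp fin_isometric"
    by (auto simp: symp_def fin_isometric_def intro: isometric_sym)
  show "transp fin_isometric"
    by (auto simp: transp_def fin_isometric_def intro: isometric_trans)
qed

instantiation eh1 :: metric_space
begin

lift_definition dist_eh1 :: "eh1 \<Rightarrow> eh1 \<Rightarrow> real" is eh_dist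
  unfolding fin_isometric_def by (auto intro: eh_dist_cong_isometric)

definition uniformity_eh1 :: "(eh1 \<times> eh1) filter" where
  "uniformity_eh1 = (INF e\<in>{0<..}. principal {(x, y). dist x y < e})"

definition open_eh1 :: "eh1 set \<Rightarrow> bool" where
  "open_eh1 U \<longleftrightarrow> (\<forall>x\<in>U. eventually (\<lambda>(x', y). x' = x \<longrightarrow> y \<in> U) uniformity)"

instance
proof
  fix a b c :: eh1
  show "dist a b = 0 \<longleftrightarrow> a = b"
    by transfer (simp add: fin_isometric_def eh_dist_eq_0_iff)
  show "dist a b \<le> dist a c + dist b c"
    by transfer (metis fin_isometric_def eh_dist_triangle eh_dist_commute)
qed (rule uniformity_eh1_def open_eh1_def)+

end

section \<open>Coarse embeddings and uniform convexity\<close>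

definition coarse_embedding :: "('a::metric_space \<Rightarrow> 'b::metric_space) \<Rightarrow> bool" where
  "coarse_embedding \<psi> \<longleftrightarrow>
     (\<exists>\<rho>\<^sub>1 \<rho>\<^sub>2 :: real \<Rightarrow> real.
        (\<forall>t\<ge>0. 0 \<le> \<rho>\<^sub>1 t) \<and> (\<forall>t\<ge>0. 0 \<le> \<rho>\<^sub>2 t) \<and>
        filterlim \<rho>\<^sub>1 at_top at_top \<and>
        (\<forall>x y. \<rho>\<^sub>1 (dist x y) \<le> dist (\<psi> x) (\<psi> y) \<and> dist (\<psi> x) (\<psi> y) \<le> \<rho>\<^sub>2 (dist x y)))"

definition uniformly_convex :: "'a::real_normed_vector itself \<Rightarrow> bool" where
  "uniformly_convex (_ :: 'a itself) \<longleftrightarrow>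
     (\<forall>\<epsilon>::real. 0 < \<epsilon> \<and> \<epsilon> \<le> 2 \<longrightarrow>
        (\<exists>\<delta>>0. \<forall>x y :: 'a. norm x = 1 \<and> norm y = 1 \<and> norm (x - y) \<ge> \<epsilon> \<longrightarrow>
           norm ((1 / 2) *\<^sub>R (x + y)) \<le> 1 - \<delta>))"

end

theory Submission
  imports Defs
begin

text \<open>Suppose \<open>\<psi>\<close> is a coarse embedding. Put finite pieces of the set of \<open>k\<close>-tuples
  \<open>n\<^sub>1 < n\<^sub>2 < \<dots> < n\<^sub>k\<close> of naturals into the line so that interlacing tuples are at
  Hausdorff distance at most \<open>1\<close>, while tuples of which one lies entirely to the left of the other
  are at Euclidean-Hausdorff distance at least \<open>k / 2\<close>. In a uniformly convex space, averages of
  bounded sequences over suitable blocks moving to infinity converge. Taking such limits one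
  coordinate after another, one finds tuples \<open>a < b\<close> such that averages of \<open>\<psi>\<close> over
  certain tuples interlacing with \<open>a\<close> and over certain tuples interlacing with \<open>b\<close> nearly agree.
  Hence \<open>\<parallel>\<psi> a - \<psi> b\<parallel>\<close> is bounded independently of \<open>k\<close>, a contradiction. This follows
  Kalton's argument for infinite interlacing graphs in reflexive spaces. The line only contains
  finite pieces of these graphs, so all limits are taken along a filter on the size of the piece, which
  plays the role of an ultrapower.\<close>

section \<open>Uniform convexity for squared norms, and a limit filter\<close>

text \<open>If the norms differ by at least \<open>e / 4\<close>, strict convexity of squaring gives
  the gain. Otherwise both norms are at least \<open>e / 4\<close>, so the vectors can be normalised
  and the modulus of convexity applies to the unit vectors.\<close>

lemma uniformly_convex_norm_square:
  assumes uc: "uniformly_convex TYPE('a::real_normed_vector)" and e: "0 < e" and B: "0 < B"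
  obtains d where "0 < d"
    "\<And>x y :: 'a. norm x \<le> B \<Longrightarrow> norm y \<le> B \<Longrightarrow> e \<le> norm (x - y) \<Longrightarrow>
      (norm ((1/2) *\<^sub>R (x + y)))\<^sup>2 \<le> ((norm x)\<^sup>2 + (norm y)\<^sup>2) / 2 - d"
proof -
  obtain d1 where d1: "0 < d1" "\<And>x y :: 'a. norm x = 1 \<Longrightarrow> norm y = 1 \<Longrightarrow>
      min 2 (e / (2 * B)) \<le> norm (x - y) \<Longrightarrow> norm ((1/2) *\<^sub>R (x + y)) \<le> 1 - d1"
    using uc e B unfolding uniformly_convex_def
    by (metis divide_pos_pos min.bounded_iff min_less_iff_conj mult_pos_pos order_refl zero_less_numeral
        min.cobounded1)
  define d0 where "d0 = min d1 1"
  define c where "c = e * d0 / 4"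
  define d where "d = min ((e/4)\<^sup>2 / 4) (e / 4 * c)"
  have d0: "0 < d0" "d0 \<le> 1" "d0 \<le> d1" using d1(1) by (auto simp: d0_def)
  have c: "0 < c" "c \<le> e / 4" using e d0 by (auto simp: c_def)
  have main: "(norm ((1/2) *\<^sub>R (x + y)))\<^sup>2 \<le> ((norm x)\<^sup>2 + (norm y)\<^sup>2) / 2 - d"
    if xy: "norm x \<le> B" "norm y \<le> B" "e \<le> norm (x - y)" "norm y \<le> norm x" for x y :: 'a
  proof -
    define a b where "a = norm x" and "b = norm y"
    define s where "s = (a + b) / 2"
    have ab: "0 \<le> b" "b \<le> a" "a \<le> B" using xy by (auto simp: a_def b_def)
    have mid: "norm ((1/2) *\<^sub>R (x + y)) \<le> s"
      using norm_triangle_ineq[of x y] by (simp add: s_def a_def b_def)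
    have s2: "s\<^sup>2 = (a\<^sup>2 + b\<^sup>2) / 2 - (a - b)\<^sup>2 / 4"
      by (simp add: s_def power2_eq_square field_simps)
    have "(norm ((1/2) *\<^sub>R (x + y)))\<^sup>2 \<le> (a\<^sup>2 + b\<^sup>2) / 2 - d"
    proof (cases "e / 4 \<le> a - b")
      case True
      then have "(e/4)\<^sup>2 \<le> (a - b)\<^sup>2" using e by (intro power_mono) auto
      then have "d \<le> (a - b)\<^sup>2 / 4" by (simp add: d_def)
      moreover have "(norm ((1/2) *\<^sub>R (x + y)))\<^sup>2 \<le> s\<^sup>2" using mid by (intro power_mono) auto
      ultimately show ?thesis using s2 by linarith
    next
      case False
      have "e \<le> a + b" using xy(3) norm_triangle_ineq4[of x y] by (simp add: a_def b_def)
      then have ae: "e / 2 \<le> a" and be: "e / 4 \<le> b" using ab False by auto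
      then have pos: "0 < a" "0 < b" using e by auto
      define x' y' where "x' = (1/a) *\<^sub>R x" and "y' = (1/b) *\<^sub>R y"
      have n1: "norm x' = 1" "norm y' = 1" using pos by (auto simp: x'_def y'_def a_def b_def)
      have xx: "x = a *\<^sub>R x'" "y = b *\<^sub>R y'" using pos by (auto simp: x'_def y'_def)
      have "x - y = a *\<^sub>R (x' - y') + (a - b) *\<^sub>R y'" by (simp add: xx algebra_simps)
      then have "norm (x - y) \<le> norm (a *\<^sub>R (x' - y')) + norm ((a - b) *\<^sub>R y')"
        by (simp only: norm_triangle_ineq)
      then have "e \<le> a * norm (x' - y') + (a - b)" using xy(3) ab pos n1 by simp
      then have "e / 2 \<le> a * norm (x' - y')" using False e by simp
      also have "\<dots> \<le> B * norm (x' - y')" using ab by (intro mult_right_mono) auto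
      finally have "e / (2 * B) \<le> norm (x' - y')" using B by (simp add: field_simps)
      then have "norm ((1/2) *\<^sub>R (x' + y')) \<le> 1 - d1" using d1(2) n1 by simp
      then have m0: "norm ((1/2) *\<^sub>R (x' + y')) \<le> 1 - d0" using d0 by simp
      \<comment> \<open>Convexity shortens only the common part of length \<open>b\<close>; the
        excess \<open>a - b\<close> is left to the triangle inequality.\<close>
      have "x + y = b *\<^sub>R (x' + y') + (a - b) *\<^sub>R x'" by (simp add: xx algebra_simps)
      then have "(1/2) *\<^sub>R (x + y) = b *\<^sub>R ((1/2) *\<^sub>R (x' + y')) + ((a - b) / 2) *\<^sub>R x'"
        by (simp only: scaleR_add_right) (simp add: scaleR_add_right)
      then have "norm ((1/2) *\<^sub>R (x + y)) \<le>
          norm (b *\<^sub>R ((1/2) *\<^sub>R (x' + y'))) + norm (((a - b) / 2) *\<^sub>R x')"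
        by (metis norm_triangle_ineq)
      also have "\<dots> = b * norm ((1/2) *\<^sub>R (x' + y')) + (a - b) / 2" using ab n1 by simp
      also have "\<dots> \<le> b * (1 - d0) + (a - b) / 2" by (intro add_right_mono mult_left_mono m0 ab)
      also have "\<dots> = s - b * d0" by (simp add: s_def field_simps)
      also have "\<dots> \<le> s - c" using be d0 by (simp add: c_def mult_right_mono[of "e/4" b d0, simplified])
      finally have "(norm ((1/2) *\<^sub>R (x + y)))\<^sup>2 \<le> (s - c)\<^sup>2" by (intro power_mono) auto
      also have "\<dots> = s\<^sup>2 - s * c - c * (s - c)" by (simp add: power2_eq_square algebra_simps)
      also have "\<dots> \<le> s\<^sup>2 - s * c"
      proof -
        have "c \<le> s" using c be ab by (simp add: s_def)
        then show ?thesis using c by simp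
      qed
      also have "\<dots> \<le> s\<^sup>2 - e / 4 * c"
      proof -
        have "e / 4 \<le> s" using be ab by (simp add: s_def)
        then show ?thesis using c by (simp add: mult_right_mono[of "e/4" s c, simplified])
      qed
      also have "\<dots> \<le> s\<^sup>2 - d" by (simp add: d_def)
      also have "s\<^sup>2 - d \<le> (a\<^sup>2 + b\<^sup>2) / 2 - d" using s2 by simp
      finally show ?thesis .
    qed
    then show ?thesis by (simp add: a_def b_def)
  qed
  show ?thesis
  proof
    show "0 < d" using e c by (simp add: d_def)
    show "(norm ((1/2) *\<^sub>R (x + y)))\<^sup>2 \<le> ((norm x)\<^sup>2 + (norm y)\<^sup>2) / 2 - d"
      if xy: "norm x \<le> B" "norm y \<le> B" "e \<le> norm (x - y)" for x y :: 'a
    proof (cases "norm y \<le> norm x")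
      case True then show ?thesis using main[of x y] xy by simp
    next
      case False
      then show ?thesis using main[of y x] xy by (simp add: norm_minus_commute add.commute)
    qed
  qed
qed

text \<open>A substitute for a free ultrafilter: a cluster point, in the compact product of the closures
  of all bounded sequences \<open>r\<close>, of the points \<open>(r n)\<^sub>r\<close>.\<close>

lemma ex_limit_filter:
  "\<exists>G :: nat filter. G \<noteq> bot \<and> G \<le> sequentially \<and>
     (\<forall>r :: nat \<Rightarrow> real. bounded (range r) \<longrightarrow> (\<exists>l. (r \<longlongrightarrow> l) G))"
proof -
  \<comment> \<open>Unbounded sequences get the factor \<open>{0}\<close>, so every factor is
    compact and Tychonoff's theorem applies.\<close>
  define K :: "((nat \<Rightarrow> real) \<Rightarrow> real) set"
    where "K = PiE UNIV (\<lambda>r. if bounded (range r) then closure (range r) else {0})"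
  define Q :: "nat \<Rightarrow> (nat \<Rightarrow> real) \<Rightarrow> real"
    where "Q = (\<lambda>n r. if bounded (range r) then r n else 0)"
  have "compactin (product_topology (\<lambda>_. euclidean) UNIV) K"
    unfolding K_def compactin_PiE by (auto simp: compact_closure)
  then have K: "compact K"
    by (simp add: euclidean_product_topology)
  have QK: "Q n \<in> K" for n
    unfolding K_def Q_def by (auto intro!: subsetD[OF closure_subset])
  obtain q where q: "inf (nhds q) (filtermap Q sequentially) \<noteq> bot"
    using K[unfolded compact_filter, rule_format, of "filtermap Q sequentially"] QK
    by (auto simp: filtermap_bot_iff eventually_filtermap)
  \<comment> \<open>The pullback makes \<open>Q\<close> tend to \<open>q\<close> along
    \<open>G\<close>; that \<open>G\<close> is proper says exactly that \<open>q\<close> is a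
    cluster point of \<open>Q\<close>.\<close>
  define G where "G = inf sequentially (filtercomap Q (nhds q))"
  have "G \<noteq> bot"
  proof
    assume "G = bot"
    then obtain P P' where P: "eventually P sequentially" "eventually P' (nhds q)" "\<And>n. P n \<Longrightarrow> \<not> P' (Q n)"
      unfolding G_def trivial_limit_def eventually_inf eventually_filtercomap by metis
    have "eventually (\<lambda>p. \<not> P' p) (filtermap Q sequentially)"
      using P(1) unfolding eventually_filtermap by eventually_elim (use P(3) in auto)
    then have "eventually (\<lambda>_. False) (inf (nhds q) (filtermap Q sequentially))"
      unfolding eventually_inf using P(2) by blast
    then show False using q by (simp add: trivial_limit_def)
  qed
  moreover have "(Q \<longlongrightarrow> q) G"
    unfolding G_def filterlim_def by (metis filtermap_filtercomap filtermap_mono inf_le2 order_trans)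
  then have lim: "((\<lambda>n. Q n r) \<longlongrightarrow> q r) G" for r
    by (rule continuous_on_tendsto_compose[of UNIV "\<lambda>p. p r", OF continuous_on_product_coordinates]) auto
  have "(r \<longlongrightarrow> q r) G" if "bounded (range r)" for r
    using lim[of r] that by (simp add: Q_def)
  ultimately show ?thesis
    unfolding G_def by (metis inf_le1)
qed

section \<open>Convex weights and averages that converge along the filter\<close>

definition conv_weights :: "nat \<Rightarrow> (nat \<Rightarrow> real) set" where
  "conv_weights s = {l. (\<forall>j. 0 \<le> l j) \<and> finite {j. l j \<noteq> 0} \<and> {j. l j \<noteq> 0} \<subseteq> {s..} \<and>
     (\<Sum>j | l j \<noteq> 0. l j) = 1}"

definition wavg :: "(nat \<Rightarrow> real) \<Rightarrow> (nat \<Rightarrow> 'a::real_vector) \<Rightarrow> 'a" where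
  "wavg l X = (\<Sum>j | l j \<noteq> 0. l j *\<^sub>R X j)"

lemma wavg_superset:
  assumes "finite F" "{j. l j \<noteq> 0} \<subseteq> F"
  shows "wavg l X = (\<Sum>j\<in>F. l j *\<^sub>R X j)"
  unfolding wavg_def using assms by (intro sum.mono_neutral_left) auto

text \<open>Closed balls are convex. With \<open>z = 0\<close> this bounds averages; with general
  \<open>z\<close> it carries the convex hull clause through the later induction.\<close>

lemma norm_wavg_diff_le:
  fixes X :: "nat \<Rightarrow> 'a::real_normed_vector"
  assumes l: "l \<in> conv_weights s" and X: "\<And>j. l j \<noteq> 0 \<Longrightarrow> norm (X j - z) \<le> r"
  shows "norm (wavg l X - z) \<le> r"
proof -
  let ?F = "{j. l j \<noteq> 0}"
  have l1: "sum l ?F = 1" and nn: "\<And>j. 0 \<le> l j" using l by (auto simp: conv_weights_def)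
  have "wavg l X - z = (\<Sum>j\<in>?F. l j *\<^sub>R (X j - z))"
    using l1 by (simp add: wavg_def scaleR_diff_right sum_subtractf flip: scaleR_left.sum)
  also have "norm \<dots> \<le> (\<Sum>j\<in>?F. l j * r)"
    using X nn by (intro sum_norm_le) (auto intro!: mult_left_mono)
  also have "\<dots> = r" using l1 by (simp flip: sum_distrib_right)
  finally show ?thesis .
qed

lemma conv_weights_midpoint:
  assumes "l \<in> conv_weights s" "l' \<in> conv_weights s"
  shows "(\<lambda>j. (l j + l' j) / 2) \<in> conv_weights s"
    and "wavg (\<lambda>j. (l j + l' j) / 2) X = (1/2) *\<^sub>R (wavg l X + wavg l' X)"
proof -
  let ?m = "\<lambda>j. (l j + l' j) / 2" and ?F = "{j. l j \<noteq> 0} \<union> {j. l' j \<noteq> 0}"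
  have fin: "finite ?F" "?F \<subseteq> {s..}" and nn: "\<And>j. 0 \<le> l j" "\<And>j. 0 \<le> l' j"
    using assms by (auto simp: conv_weights_def)
  have sub: "{j. ?m j \<noteq> 0} \<subseteq> ?F" by auto
  have sums: "sum l ?F = 1" "sum l' ?F = 1" "sum ?m {j. ?m j \<noteq> 0} = sum ?m ?F"
  proof -
    have "sum l ?F = sum l {j. l j \<noteq> 0}" "sum l' ?F = sum l' {j. l' j \<noteq> 0}"
      using fin by (auto intro!: sum.mono_neutral_right)
    then show "sum l ?F = 1" "sum l' ?F = 1" using assms by (simp_all add: conv_weights_def)
    show "sum ?m {j. ?m j \<noteq> 0} = sum ?m ?F" using fin sub by (intro sum.mono_neutral_left) auto
  qed
  have "sum ?m ?F = 1" using sums by (simp add: sum.distrib flip: sum_divide_distrib)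
  moreover have "finite {j. ?m j \<noteq> 0}" "{j. ?m j \<noteq> 0} \<subseteq> {s..}"
    using fin sub finite_subset by blast+
  ultimately show "?m \<in> conv_weights s"
    unfolding conv_weights_def using nn sums(3) by (auto simp del: divide_eq_0_iff)
  have "wavg ?m X = (\<Sum>j\<in>?F. ?m j *\<^sub>R X j)" using fin sub by (intro wavg_superset) auto
  also have "\<dots> = (1/2) *\<^sub>R ((\<Sum>j\<in>?F. l j *\<^sub>R X j) + (\<Sum>j\<in>?F. l' j *\<^sub>R X j))"
    by (simp add: scaleR_sum_right scaleR_add_left add_divide_distrib scaleR_add_right flip: sum.distrib)
  also have "\<dots> = (1/2) *\<^sub>R (wavg l X + wavg l' X)"
    using fin by (simp add: wavg_superset[of ?F])
  finally show "wavg ?m X = (1/2) *\<^sub>R (wavg l X + wavg l' X)" .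
qed

text \<open>This makes all midpoint defects in a series nonnegative, so that a single defect is at
  most their sum.\<close>

lemma norm_square_midpoint_le:
  fixes x y :: "'a::real_normed_vector"
  shows "(norm ((1/2) *\<^sub>R (x + y)))\<^sup>2 \<le> ((norm x)\<^sup>2 + (norm y)\<^sup>2) / 2"
proof -
  have "norm ((1/2) *\<^sub>R (x + y)) \<le> (norm x + norm y) / 2"
    using norm_triangle_ineq[of x y] by simp
  then have "(norm ((1/2) *\<^sub>R (x + y)))\<^sup>2 \<le> ((norm x + norm y) / 2)\<^sup>2"
    by (intro power_mono) auto
  also have "\<dots> = ((norm x)\<^sup>2 + (norm y)\<^sup>2) / 2 - (norm x - norm y)\<^sup>2 / 4"
    by (simp add: power2_eq_square field_simps)
  finally show ?thesis using zero_le_power2[of "norm x - norm y"] by linarith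
qed

text \<open>The weights \<open>l s\<close> nearly minimise, among those supported in \<open>{s..}\<close>, the limit along
  \<open>G\<close> of a weighted sum over all \<open>t\<close> of the squared norms of the averages. The minima increase
  with \<open>s\<close> to a limit, so midpoints cannot do much better, and uniform convexity forces the
  averages together.\<close>

lemma uniformly_convex_cauchy_weights:
  fixes x :: "nat \<Rightarrow> nat \<Rightarrow> nat \<Rightarrow> 'a::real_normed_vector"
  assumes uc: "uniformly_convex TYPE('a)"
    and G: "G \<noteq> bot" "\<And>r :: nat \<Rightarrow> real. bounded (range r) \<Longrightarrow> \<exists>l. (r \<longlongrightarrow> l) G"
    and B: "\<And>t j N. norm (x t j N) \<le> B"
  obtains l where "\<And>s. l s \<in> conv_weights s"
    "\<And>t e. 0 < e \<Longrightarrow> \<exists>s0. \<forall>s\<ge>s0. \<forall>s'\<ge>s0. \<forall>\<^sub>F N in G.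
       norm (wavg (l s) (\<lambda>j. x t j N) - wavg (l s') (\<lambda>j. x t j N)) < e"
proof -
  define A where "A l t N = wavg l (\<lambda>j. x t j N)" for l t N
  \<comment> \<open>The factors \<open>(1/2)^t\<close> make the series converge, so that one choice
    of weights serves all \<open>t\<close> at once.\<close>
  define r where "r l N = (\<Sum>t. (1/2)^t * (norm (A l t N))\<^sup>2)" for l N
  have A: "norm (A l t N) \<le> B" if "l \<in> conv_weights s" for l s t N
    using norm_wavg_diff_le[OF that, of "\<lambda>j. x t j N" 0 B] B by (simp add: A_def)
  have "0 \<le> B" using B[of 0 0 0] norm_ge_zero order_trans by blast
  have half: "summable (\<lambda>t. (1/2)^t * c)" "(\<Sum>t. (1/2)^t * c) = 2 * c" for c :: real
    by (auto intro!: summable_mult2 simp: suminf_mult2[symmetric] suminf_geometric)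
  have term_le: "(1/2)^t * (norm (A l t N))\<^sup>2 \<le> (1/2)^t * B\<^sup>2" if "l \<in> conv_weights s" for l s t N
    using A[OF that, of t N] by (intro mult_left_mono power_mono) auto
  have sm: "summable (\<lambda>t. (1/2)^t * (norm (A l t N))\<^sup>2)" if "l \<in> conv_weights s" for l s N
    by (rule summable_comparison_test'[OF half(1)[of "B\<^sup>2"], of 0]) (use term_le[OF that] in simp)
  have r0: "0 \<le> r l N" "r l N \<le> 2 * B\<^sup>2" if "l \<in> conv_weights s" for l s N
  proof -
    show "0 \<le> r l N" unfolding r_def using sm[OF that] by (intro suminf_nonneg) auto
    show "r l N \<le> 2 * B\<^sup>2"
      unfolding r_def half(2)[symmetric] using sm[OF that] half(1) term_le[OF that] by (intro suminf_le) auto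
  qed
  have "\<exists>v. (r l \<longlongrightarrow> v) G" if "l \<in> conv_weights s" for l s
    using r0[OF that] by (intro G(2) boundedI[of _ "2 * B\<^sup>2"]) auto
  then obtain \<Phi> where \<Phi>: "\<And>l s. l \<in> conv_weights s \<Longrightarrow> (r l \<longlongrightarrow> \<Phi> l) G" by metis
  have \<Phi>0: "0 \<le> \<Phi> l" "\<Phi> l \<le> 2 * B\<^sup>2" if "l \<in> conv_weights s" for l s
    using tendsto_lowerbound[OF \<Phi>[OF that], of 0] tendsto_upperbound[OF \<Phi>[OF that], of "2 * B\<^sup>2"]
      r0[OF that] G(1) by auto
  define D where "D s = Inf (\<Phi> ` conv_weights s)" for s
  have ne: "conv_weights s \<noteq> {}" for s
  proof -
    have "(\<lambda>j. if j = s then 1 else 0) \<in> conv_weights s" by (auto simp: conv_weights_def)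
    then show ?thesis by blast
  qed
  have D_le: "D s \<le> \<Phi> l" if "l \<in> conv_weights s" for l s
    unfolding D_def using that \<Phi>0 by (intro cINF_lower bdd_belowI[of _ 0]) auto
  have mono: "conv_weights s' \<subseteq> conv_weights s" if "s \<le> s'" for s s'
    using that by (fastforce simp: conv_weights_def)
  have D_mono: "D s \<le> D s'" if "s \<le> s'" for s s'
    unfolding D_def[of s'] using D_le mono[OF that] ne by (intro cINF_greatest) auto
  have D_ub: "D s \<le> 2 * B\<^sup>2" for s using D_le \<Phi>0 ne by (meson all_not_in_conv order_trans)
  obtain d where d: "D \<longlonglongrightarrow> d" "\<And>s. D s \<le> d"
    using incseq_convergent[of D "2 * B\<^sup>2"] D_mono D_ub unfolding incseq_def by auto
  have "\<exists>l \<in> conv_weights s. \<Phi> l < D s + 1 / (real s + 1)" for s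
  proof -
    have "Inf (\<Phi> ` conv_weights s) < D s + 1 / (real s + 1)" by (simp add: D_def)
    then show ?thesis using cInf_lessD[of "\<Phi> ` conv_weights s"] ne by auto
  qed
  then obtain l where l: "\<And>s. l s \<in> conv_weights s" "\<And>s. \<Phi> (l s) < D s + 1 / (real s + 1)"
    by metis
  show ?thesis
  proof
    show "l s \<in> conv_weights s" for s by (rule l)
    fix t and e :: real assume "0 < e"
    \<comment> \<open>The bound must be positive, and \<open>B\<close> may be 0; hence
      \<open>B + 1\<close>.\<close>
    obtain \<delta> where \<delta>: "0 < \<delta>" "\<And>u v :: 'a. norm u \<le> B + 1 \<Longrightarrow> norm v \<le> B + 1 \<Longrightarrow> e \<le> norm (u - v) \<Longrightarrow>
      (norm ((1/2) *\<^sub>R (u + v)))\<^sup>2 \<le> ((norm u)\<^sup>2 + (norm v)\<^sup>2) / 2 - \<delta>"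
      using uniformly_convex_norm_square[OF uc \<open>0 < e\<close>, of "B + 1"] \<open>0 \<le> B\<close>
      by (metis add_nonneg_pos zero_less_one)
    \<comment> \<open>A defect \<delta> in the \<open>t\<close>-th squared norm counts as
      \<open>\<eta>\<close> in the series.\<close>
    define \<eta> where "\<eta> = (1/2)^t * \<delta>"
    have \<eta>: "0 < \<eta>" using \<delta> by (simp add: \<eta>_def)
    have "\<forall>\<^sub>F s in sequentially. d - \<eta> / 4 < D s"
      using d(1) \<eta> by (intro order_tendstoD(1)[of D d]) auto
    moreover have "(\<lambda>s. 1 / (real s + 1)) \<longlonglongrightarrow> 0"
      using LIMSEQ_inverse_real_of_nat by (simp add: inverse_eq_divide add.commute)
    then have "\<forall>\<^sub>F s in sequentially. 1 / (real s + 1) < \<eta> / 4"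
      using \<eta> by (intro order_tendstoD(2)[of _ 0]) auto
    ultimately obtain s0 where s0: "\<And>s. s0 \<le> s \<Longrightarrow> d - \<eta> / 4 < D s \<and> 1 / (real s + 1) < \<eta> / 4"
      by (metis (mono_tags, lifting) eventually_conj eventually_sequentially)
    show "\<exists>s0. \<forall>s\<ge>s0. \<forall>s'\<ge>s0. \<forall>\<^sub>F N in G.
       norm (wavg (l s) (\<lambda>j. x t j N) - wavg (l s') (\<lambda>j. x t j N)) < e"
    proof (intro exI allI impI)
      fix s s' assume s: "s0 \<le> s" "s0 \<le> s'"
      define m where "m = (\<lambda>j. (l s j + l s' j) / 2)"
      have ls: "l s \<in> conv_weights s0" "l s' \<in> conv_weights s0" using l mono s by blast+
      have m: "m \<in> conv_weights s0" and
        Am: "\<And>t N. A m t N = (1/2) *\<^sub>R (A (l s) t N + A (l s') t N)"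
        unfolding m_def A_def using conv_weights_midpoint[OF ls] by auto
      \<comment> \<open>The midpoint is supported in \<open>{s0..}\<close>, so its limit value is at
        least \<open>D s0\<close>, while both near minimisers stay below
        \<open>d + \<eta> / 4\<close>.\<close>
      have "d - \<eta> / 4 < \<Phi> m" using s0[of s0] D_le[OF m] by simp
      moreover have "\<Phi> (l s) < d + \<eta> / 4" "\<Phi> (l s') < d + \<eta> / 4"
        using l(2)[of s] l(2)[of s'] s0[OF s(1)] s0[OF s(2)] d(2)[of s] d(2)[of s'] by linarith+
      ultimately have "\<forall>\<^sub>F N in G. d - \<eta> / 4 < r m N" "\<forall>\<^sub>F N in G. r (l s) N < d + \<eta> / 4"
        "\<forall>\<^sub>F N in G. r (l s') N < d + \<eta> / 4"
        using \<Phi>[OF m] \<Phi>[OF ls(1)] \<Phi>[OF ls(2)] by (auto intro: order_tendstoD)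
      then have "\<forall>\<^sub>F N in G. norm (A (l s) t N - A (l s') t N) < e"
      proof eventually_elim
        case (elim N)
        \<comment> \<open>The gaps are nonnegative and sum to less than \<open>\<eta>\<close>;
          averages at distance \<open>e\<close> would make the \<open>t\<close>-th gap alone at
          least \<open>\<eta>\<close>.\<close>
        define gap where "gap i = (1/2)^i * (((norm (A (l s) i N))\<^sup>2 + (norm (A (l s') i N))\<^sup>2) / 2 -
          (norm (A m i N))\<^sup>2)" for i
        have gap0: "0 \<le> gap i" for i
          unfolding gap_def Am using norm_square_midpoint_le[of "A (l s) i N" "A (l s') i N"] by simp
        have "(\<lambda>i. ((1/2)^i * (norm (A (l s) i N))\<^sup>2 + (1/2)^i * (norm (A (l s') i N))\<^sup>2) / 2 -
            (1/2)^i * (norm (A m i N))\<^sup>2) sums ((r (l s) N + r (l s') N) / 2 - r m N)"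
          unfolding r_def by (intro sums_diff sums_divide sums_add summable_sums sm[OF ls(1)] sm[OF ls(2)] sm[OF m])
        then have sums: "gap sums ((r (l s) N + r (l s') N) / 2 - r m N)"
          unfolding gap_def by (simp add: algebra_simps add_divide_distrib)
        have "gap t \<le> suminf gap"
          using sum_le_suminf[of gap "{t}"] sums gap0 by (auto simp: sums_iff)
        also have "\<dots> < \<eta>" using sums_unique[OF sums] elim \<eta> by argo
        finally have lt: "gap t < \<eta>" .
        show ?case
        proof (rule ccontr)
          assume "\<not> ?thesis"
          then have "\<delta> \<le> ((norm (A (l s) t N))\<^sup>2 + (norm (A (l s') t N))\<^sup>2) / 2 - (norm (A m t N))\<^sup>2"
            using \<delta>(2)[of "A (l s) t N" "A (l s') t N"] A[OF ls(1), of t N] A[OF ls(2), of t N] unfolding Am by auto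
          then have "\<eta> \<le> gap t" unfolding \<eta>_def gap_def by (intro mult_left_mono) auto
          then show False using lt by simp
        qed
      qed
      then show "\<forall>\<^sub>F N in G. norm (wavg (l s) (\<lambda>j. x t j N) - wavg (l s') (\<lambda>j. x t j N)) < e"
        by (simp add: A_def)
    qed
  qed
qed

section \<open>Interlacing tuples and iterated limits\<close>

text \<open>The tuple being interlaced is \<open>c 0, ..., c (k - 1)\<close>; the extra value
  \<open>c k\<close> bounds the last entry.\<close>

definition interlacing :: "nat \<Rightarrow> (nat \<Rightarrow> nat) \<Rightarrow> nat list set" where
  "interlacing k c = {n. length n = k \<and> (\<forall>i<k. c i \<le> n ! i \<and> n ! i < c (Suc i))}"

text \<open>Finiteness allows taking the maximum of thresholds over all interlacing tuples and
  intersecting the corresponding eventual statements.\<close>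

lemma finite_interlacing: "finite (interlacing k c)"
proof (rule finite_subset)
  show "interlacing k c \<subseteq> {n. set n \<subseteq> (\<Union>i<k. {..<c (Suc i)}) \<and> length n = k}"
    by (fastforce simp: interlacing_def in_set_conv_nth)
  show "finite {n. set n \<subseteq> (\<Union>i<k. {..<c (Suc i)}) \<and> length n = k}"
    by (rule finite_lists_length_eq) auto
qed

lemma interlacing_snoc:
  assumes "n \<in> interlacing k c" "c k \<le> j" "j < u"
  shows "n @ [j] \<in> interlacing (Suc k) (c(Suc k := u))"
  using assms by (auto simp: interlacing_def nth_append less_Suc_eq)

text \<open>The last clause says that \<open>x N\<close> is \<open>e\<close>-close to the convex hull of the values
  \<open>f n N\<close> with \<open>n\<close> interlacing \<open>c\<close>. The point is that \<open>x\<close> does not depend on where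
  \<open>c\<close> starts.\<close>

lemma uniformly_convex_interlacing_limit:
  fixes f :: "nat list \<Rightarrow> nat \<Rightarrow> 'a::real_normed_vector"
  assumes uc: "uniformly_convex TYPE('a)"
    and G: "G \<noteq> bot" "\<And>r :: nat \<Rightarrow> real. bounded (range r) \<Longrightarrow> \<exists>l. (r \<longlongrightarrow> l) G"
    and B: "\<And>n N. norm (f n N) \<le> B" and e: "0 < e"
  shows "\<exists>x. \<forall>m. \<exists>c. c 0 = m \<and> (\<forall>i<k. c i \<le> c (Suc i)) \<and>
     (\<forall>\<^sub>F N in G. \<forall>z r. (\<forall>n\<in>interlacing k c. norm (f n N - z) \<le> r) \<longrightarrow> norm (x N - z) \<le> r + e)"
  using B e
proof (induction k arbitrary: f e)
  case 0
  show ?case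
  proof (intro exI allI conjI)
    fix m :: nat
    show "(\<lambda>_::nat. m) 0 = m" by simp
    show "\<forall>\<^sub>F N in G. \<forall>z r. (\<forall>n\<in>interlacing 0 (\<lambda>_. m). norm (f n N - z) \<le> r) \<longrightarrow> norm (f [] N - z) \<le> r + e"
      using 0(2) by (intro always_eventually) (force simp: interlacing_def)
  qed simp
next
  case (Suc k)
  \<comment> \<open>Enumerating the lists of initial coordinates by naturals gives one family of
    weights for the last coordinate, common to all of them.\<close>
  define y where "y t j N = f (from_nat t @ [j]) N" for t j N
  obtain l where l: "\<And>s. l s \<in> conv_weights s" and cauchy:
    "\<And>t e. 0 < e \<Longrightarrow> \<exists>s0. \<forall>s\<ge>s0. \<forall>s'\<ge>s0. \<forall>\<^sub>F N in G.
       norm (wavg (l s) (\<lambda>j. y t j N) - wavg (l s') (\<lambda>j. y t j N)) < e"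
    using uniformly_convex_cauchy_weights[OF uc G, of y B] Suc.prems(1) unfolding y_def by blast
  define F where "F s t N = wavg (l s) (\<lambda>j. f (t @ [j]) N)" for s t N
  have "\<exists>s0. \<forall>s\<ge>s0. \<forall>s'\<ge>s0. \<forall>\<^sub>F N in G. norm (F s t N - F s' t N) < e / 2" for t
    using cauchy[of "e / 2" "to_nat t"] Suc.prems(2) by (simp add: y_def F_def)
  then obtain s0 where "\<And>t. \<forall>s\<ge>s0 t. \<forall>s'\<ge>s0 t. \<forall>\<^sub>F N in G. norm (F s t N - F s' t N) < e / 2"
    by metis
  then have s0: "\<And>t s s'. s0 t \<le> s \<Longrightarrow> s0 t \<le> s' \<Longrightarrow>
      \<forall>\<^sub>F N in G. norm (F s t N - F s' t N) < e / 2" by blast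
  have "norm (F (s0 t) t N) \<le> B" for t N
    using norm_wavg_diff_le[OF l, of _ "\<lambda>j. f (t @ [j]) N" 0 B] Suc.prems(1) by (simp add: F_def)
  \<comment> \<open>\<open>F (s0 t) t\<close> stands in for the limit over the last coordinate, with
    error \<open>e / 2\<close>; the induction hypothesis spends the other half.\<close>
  then obtain x where x: "\<And>m. \<exists>c. c 0 = m \<and> (\<forall>i<k. c i \<le> c (Suc i)) \<and>
     (\<forall>\<^sub>F N in G. \<forall>z r. (\<forall>t\<in>interlacing k c. norm (F (s0 t) t N - z) \<le> r) \<longrightarrow> norm (x N - z) \<le> r + e / 2)"
    using Suc.IH[of "\<lambda>t. F (s0 t) t" "e / 2"] Suc.prems(2) by auto
  show ?case
  proof (intro exI[of _ x] allI)
    fix m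
    obtain c where c: "c 0 = m" "\<forall>i<k. c i \<le> c (Suc i)" and
      xN: "\<forall>\<^sub>F N in G. \<forall>z r. (\<forall>t\<in>interlacing k c. norm (F (s0 t) t N - z) \<le> r) \<longrightarrow> norm (x N - z) \<le> r + e / 2"
      using x by blast
    \<comment> \<open>Starting at \<open>s\<close> puts the last coordinate to the right of
      \<open>c k\<close> and passes the thresholds of all relevant \<open>t\<close>. The threshold
      can be chosen only now, when \<open>c\<close> is known, but \<open>x\<close> does not depend
      on it.\<close>
    define s where "s = Max (insert (c k) (s0 ` interlacing k c))"
    have s: "c k \<le> s" "\<And>t. t \<in> interlacing k c \<Longrightarrow> s0 t \<le> s"
      using finite_interlacing by (auto simp: s_def)
    have supp: "finite {j. l s j \<noteq> 0}" "{j. l s j \<noteq> 0} \<subseteq> {s..}"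
      using l[of s] by (auto simp: conv_weights_def)
    then obtain u where u: "\<And>j. l s j \<noteq> 0 \<Longrightarrow> j < u"
      using finite_nat_set_iff_bounded by auto
    define c' where "c' = c(Suc k := max u (c k))"
    have close: "\<forall>\<^sub>F N in G. \<forall>t\<in>interlacing k c. norm (F (s0 t) t N - F s t N) < e / 2"
      using s0 s(2) finite_interlacing by (intro eventually_ball_finite) auto
    show "\<exists>c. c 0 = m \<and> (\<forall>i<Suc k. c i \<le> c (Suc i)) \<and>
      (\<forall>\<^sub>F N in G. \<forall>z r. (\<forall>n\<in>interlacing (Suc k) c. norm (f n N - z) \<le> r) \<longrightarrow> norm (x N - z) \<le> r + e)"
    proof (intro exI[of _ c'] conjI)
      show "c' 0 = m" using c by (simp add: c'_def)
      show "\<forall>i<Suc k. c' i \<le> c' (Suc i)" using c by (auto simp: c'_def less_Suc_eq)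
      show "\<forall>\<^sub>F N in G. \<forall>z r. (\<forall>n\<in>interlacing (Suc k) c'. norm (f n N - z) \<le> r) \<longrightarrow> norm (x N - z) \<le> r + e"
        using xN close
      proof eventually_elim
        case (elim N)
        show ?case
        proof (intro allI impI)
          fix z r assume zr: "\<forall>n\<in>interlacing (Suc k) c'. norm (f n N - z) \<le> r"
          have "norm (F (s0 t) t N - z) \<le> r + e / 2" if t: "t \<in> interlacing k c" for t
          proof -
            have "norm (f (t @ [j]) N - z) \<le> r" if "l s j \<noteq> 0" for j
            proof -
              have "c k \<le> j" "j < u" using s(1) supp(2) u that by fastforce+
              then have "t @ [j] \<in> interlacing (Suc k) c'" unfolding c'_def by (intro interlacing_snoc t) auto
              then show ?thesis using zr by blast
            qed
            then have "norm (F s t N - z) \<le> r" unfolding F_def by (intro norm_wavg_diff_le[OF l])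
            moreover have "norm (F (s0 t) t N - F s t N) < e / 2" using elim(2) t by blast
            ultimately show ?thesis
              using norm_triangle_ineq[of "F (s0 t) t N - F s t N" "F s t N - z"] by simp
          qed
          then show "norm (x N - z) \<le> r + e" using elim(1) by fastforce
        qed
      qed
    qed
  qed
qed

section \<open>Estimates for the Euclidean-Hausdorff distance\<close>

lemma correspondence_rightE:
  assumes "correspondence X Y R" "y \<in> Y"
  obtains x where "x \<in> X" "(x, y) \<in> R"
  using assms unfolding correspondence_def by blast

text \<open>Embeddings preserve lengths, and each endpoint contributes an error below
  \<open>e\<close>. Lower bounds on \<open>eh_dist\<close> thus need not mention isometries.\<close>

lemma eh_dist_less_distortion:
  assumes "finite X" "X \<noteq> {}" "finite Y" "Y \<noteq> {}" and lt: "eh_dist X Y < e"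
  obtains R where "correspondence X Y R"
    "\<And>x y x' y'. (x, y) \<in> R \<Longrightarrow> (x', y') \<in> R \<Longrightarrow> \<bar>\<bar>x - x'\<bar> - \<bar>y - y'\<bar>\<bar> < 2 * e"
proof -
  obtain i j :: "real \<Rightarrow> real" and R where
    i: "isometric_embedding_on X i" and j: "isometric_embedding_on Y j" and
    R: "correspondence X Y R" "\<forall>(x, y)\<in>R. \<bar>i x - j y\<bar> < e"
    using lt eh_dist_less_iff[OF assms(1-4)] by blast
  show ?thesis
  proof
    show "correspondence X Y R" by (rule R)
    fix x y x' y' assume xy: "(x, y) \<in> R" "(x', y') \<in> R"
    then have "x \<in> X" "x' \<in> X" "y \<in> Y" "y' \<in> Y" using R(1) by (auto simp: correspondence_def)
    then have "\<bar>i x - i x'\<bar> = \<bar>x - x'\<bar>" "\<bar>j y - j y'\<bar> = \<bar>y - y'\<bar>"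
      using i j by (auto simp: isometric_embedding_on_def dist_real_def)
    moreover have "\<bar>i x - j y\<bar> < e" "\<bar>i x' - j y'\<bar> < e" using R(2) xy by auto
    then have "\<bar>(i x - i x') - (j y - j y')\<bar> < 2 * e" by linarith
    ultimately show "\<bar>\<bar>x - x'\<bar> - \<bar>y - y'\<bar>\<bar> < 2 * e"
      using abs_triangle_ineq3[of "i x - i x'" "j y - j y'"] by simp
  qed
qed

text \<open>Matching ends with ends and equal indices gives the upper bound. For the lower bound,
  the ends of the wide set are \<open>hi - lo + 2 * h\<close> apart, but any two points of the other
  at most \<open>hi - lo\<close>.\<close>

lemma eh_dist_widen:
  fixes u v :: "'i \<Rightarrow> real"
  assumes I: "finite I" and h: "0 \<le> h" and lohi: "lo \<le> hi"
    and v: "\<And>i. i \<in> I \<Longrightarrow> lo \<le> v i \<and> v i \<le> hi"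
    and uv: "\<And>i. i \<in> I \<Longrightarrow> \<bar>v i - u i\<bar> \<le> h"
  shows "eh_dist (insert lo (insert hi (v ` I))) (insert (lo - h) (insert (hi + h) (u ` I))) = h"
    (is "eh_dist ?X ?Z = h")
proof (rule antisym)
  have fin: "finite ?X" "?X \<noteq> {}" "finite ?Z" "?Z \<noteq> {}" using I by auto
  show "eh_dist ?X ?Z \<le> h"
  proof (rule dense_ge)
    fix e assume e: "h < e"
    let ?R = "insert (lo, lo - h) (insert (hi, hi + h) ((\<lambda>i. (v i, u i)) ` I))"
    have "correspondence ?X ?Z ?R" unfolding correspondence_def by auto
    moreover have "\<forall>(x, y)\<in>?R. \<bar>x - y\<bar> < e" using e h uv by force
    ultimately have "eh_dist ?X ?Z < e"
      unfolding eh_dist_less_iff[OF fin]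
      by (intro exI[of _ "\<lambda>x. x"] exI[of _ ?R]) (auto simp: isometric_embedding_on_def)
    then show "eh_dist ?X ?Z \<le> e" by simp
  qed
  show "h \<le> eh_dist ?X ?Z"
  proof (rule ccontr)
    assume "\<not> h \<le> eh_dist ?X ?Z"
    then have "eh_dist ?X ?Z < h" by simp
    then obtain R where R: "correspondence ?X ?Z R" and
      dis: "\<And>x y x' y'. (x, y) \<in> R \<Longrightarrow> (x', y') \<in> R \<Longrightarrow> \<bar>\<bar>x - x'\<bar> - \<bar>y - y'\<bar>\<bar> < 2 * h"
      using eh_dist_less_distortion[OF fin] by metis
    obtain x where x: "x \<in> ?X" "(x, lo - h) \<in> R"
      by (rule correspondence_rightE[OF R, of "lo - h"]) (simp, rule that)
    obtain x' where x': "x' \<in> ?X" "(x', hi + h) \<in> R"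
      by (rule correspondence_rightE[OF R, of "hi + h"]) (simp, rule that)
    have "lo \<le> x" "x \<le> hi" "lo \<le> x'" "x' \<le> hi" using x(1) x'(1) v lohi by auto
    then show False using dis[OF x(2) x'(2)] h lohi by linarith
  qed
qed

text \<open>The upper control function of a coarse embedding may be unbounded on bounded intervals.
  Widening one of two sets with common ends by \<open>h\<close> on both sides gives a third one at distance
  exactly \<open>h\<close> from both.\<close>

lemma dist_image_le_same_ends:
  fixes \<phi> :: "real set \<Rightarrow> 'a::metric_space" and u v :: "'i \<Rightarrow> real"
  assumes \<rho>: "\<And>X Y. finite X \<Longrightarrow> X \<noteq> {} \<Longrightarrow> finite Y \<Longrightarrow> Y \<noteq> {} \<Longrightarrow>
      dist (\<phi> X) (\<phi> Y) \<le> \<rho> (eh_dist X Y)"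
    and I: "finite I" and h: "0 \<le> h" and lohi: "lo \<le> hi"
    and u: "\<And>i. i \<in> I \<Longrightarrow> lo \<le> u i \<and> u i \<le> hi"
    and v: "\<And>i. i \<in> I \<Longrightarrow> lo \<le> v i \<and> v i \<le> hi"
    and uv: "\<And>i. i \<in> I \<Longrightarrow> \<bar>v i - u i\<bar> \<le> h"
  shows "dist (\<phi> (insert lo (insert hi (u ` I)))) (\<phi> (insert lo (insert hi (v ` I)))) \<le> 2 * \<rho> h"
proof -
  let ?X = "insert lo (insert hi (u ` I))" and ?Y = "insert lo (insert hi (v ` I))"
  let ?Z = "insert (lo - h) (insert (hi + h) (u ` I))"
  have "dist (\<phi> ?X) (\<phi> ?Z) \<le> \<rho> (eh_dist ?X ?Z)" "dist (\<phi> ?Y) (\<phi> ?Z) \<le> \<rho> (eh_dist ?Y ?Z)"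
    using I by (auto intro!: \<rho>)
  moreover have "eh_dist ?X ?Z = h" using eh_dist_widen[OF I h lohi, of u u] u h by simp
  moreover have "eh_dist ?Y ?Z = h" using eh_dist_widen[OF I h lohi, of v u] v uv by simp
  ultimately show ?thesis
    using dist_triangle2[of "\<phi> ?X" "\<phi> ?Y" "\<phi> ?Z"] by simp
qed

section \<open>Tuples encoded as subsets of the line\<close>

definition height :: "nat list \<Rightarrow> nat \<Rightarrow> nat" where
  "height n j = card {i. i < length n \<and> n ! i \<le> j}"

lemma height_le: "height n j \<le> length n"
proof -
  have "height n j \<le> card {..<length n}" unfolding height_def by (intro card_mono) auto
  then show ?thesis by simp
qed

lemma height_full: "(\<And>i. i < length n \<Longrightarrow> n ! i \<le> j) \<Longrightarrow> height n j = length n"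
  unfolding height_def by (metis (mono_tags, lifting) Collect_cong card_Collect_less_nat)

lemma height_zero: "(\<And>i. i < length n \<Longrightarrow> j < n ! i) \<Longrightarrow> height n j = 0"
  unfolding height_def by (auto simp: card_eq_0_iff) (metis leD)

text \<open>\<open>n ! i \<le> j\<close> forces \<open>c i \<le> j\<close>, and
  \<open>c (Suc i) \<le> j\<close> forces \<open>n ! i \<le> j\<close>; so the counts differ by at
  most the index 0.\<close>

lemma height_interlacing:
  assumes n: "n \<in> interlacing k c"
  shows "\<bar>real (height (map c [0..<k]) j) - real (height n j)\<bar> \<le> 1"
proof -
  have len: "length n = k" and ci: "\<And>i. i < k \<Longrightarrow> c i \<le> n ! i \<and> n ! i < c (Suc i)"
    using n by (auto simp: interlacing_def)
  let ?C = "{i. i < k \<and> c i \<le> j}" and ?N = "{i. i < k \<and> n ! i \<le> j}"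
  have H: "height (map c [0..<k]) j = card ?C" "height n j = card ?N"
    unfolding height_def len by (auto intro!: arg_cong[where f = card])
  have "?N \<subseteq> ?C" using ci by fastforce
  then have "card ?N \<le> card ?C" by (intro card_mono) auto
  moreover have "?C \<subseteq> insert 0 (Suc ` ?N)"
  proof
    fix i assume i: "i \<in> ?C"
    show "i \<in> insert 0 (Suc ` ?N)"
    proof (cases i)
      case (Suc i')
      then have "i' \<in> ?N" using i ci[of i'] by auto
      then show ?thesis using Suc by blast
    qed simp
  qed
  then have "card ?C \<le> card (insert 0 (Suc ` ?N))" by (intro card_mono) auto
  then have "card ?C \<le> Suc (card ?N)"
    using card_insert_le_m1[of "Suc (card ?N)" "Suc ` ?N" 0] card_image_le[of ?N Suc] by (simp add: card_image)
  ultimately show ?thesis using H by simp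
qed

text \<open>The spacing \<open>4k + 4\<close> exceeds the heights, so a small perturbation cannot mix up the bumps,
  and the long gap on the left rules out reflections.\<close>

definition profile :: "nat \<Rightarrow> nat \<Rightarrow> nat list \<Rightarrow> real set" where
  "profile k N n = insert (- 2 * ((4 * real k + 4) * real N)) (insert ((4 * real k + 4) * real N)
     ((\<lambda>j. (4 * real k + 4) * real j + real (height n j)) ` {..<N}))"

lemma finite_profile: "finite (profile k N n)" "profile k N n \<noteq> {}"
  by (auto simp: profile_def)

text \<open>The height is at most \<open>k\<close> and the spacing is \<open>4 * k + 4\<close>,
  which leaves the margin \<open>3 * k + 4\<close> before the right end.\<close>

lemma profile_inner:
  assumes "length n = k" "j < N"
  shows "0 \<le> (4 * real k + 4) * real j + real (height n j)"
    and "(4 * real k + 4) * real j + real (height n j) + 3 * real k + 4 \<le> (4 * real k + 4) * real N"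
proof -
  have "(4 * real k + 4) * (real j + 1) \<le> (4 * real k + 4) * real N"
    using assms(2) by (intro mult_left_mono) auto
  moreover have "real (height n j) \<le> real k" using height_le[of n j] assms(1) by simp
  ultimately show "(4 * real k + 4) * real j + real (height n j) + 3 * real k + 4 \<le> (4 * real k + 4) * real N"
    by (simp add: algebra_simps)
qed simp

text \<open>Profiles with the same \<open>k\<close> and \<open>N\<close> share their ends, as
  \<open>dist_image_le_same_ends\<close> demands; their inner points differ only in height.\<close>

lemma dist_image_profile_le:
  fixes \<phi> :: "real set \<Rightarrow> 'a::metric_space"
  assumes \<rho>: "\<And>X Y. finite X \<Longrightarrow> X \<noteq> {} \<Longrightarrow> finite Y \<Longrightarrow> Y \<noteq> {} \<Longrightarrow>
      dist (\<phi> X) (\<phi> Y) \<le> \<rho> (eh_dist X Y)"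
    and len: "length a = k" "length n = k" and h: "0 \<le> h"
    and ah: "\<And>j. \<bar>real (height a j) - real (height n j)\<bar> \<le> h"
  shows "dist (\<phi> (profile k N a)) (\<phi> (profile k N n)) \<le> 2 * \<rho> h"
  unfolding profile_def
proof (rule dist_image_le_same_ends[where \<rho> = \<rho> and \<phi> = \<phi>, OF _ finite_lessThan h], goal_cases)
  case 1
  then show ?case by (rule \<rho>)
next
  case 2
  have "0 \<le> (4 * real k + 4) * real N" by simp
  then show ?case by linarith
next
  case (3 j)
  have "0 \<le> (4 * real k + 4) * real N" by simp
  moreover have "j < N" using 3 by simp
  ultimately show ?case using profile_inner[OF len(1), of j N] by (intro conjI) linarith+
next
  case (4 j)
  have "0 \<le> (4 * real k + 4) * real N" by simp
  moreover have "j < N" using 4 by simp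
  ultimately show ?case using profile_inner[OF len(2), of j N] by (intro conjI) linarith+
next
  case (5 j)
  then show ?case using ah[of j] by simp
qed

text \<open>At position \<open>j0\<close> the height is \<open>k\<close> for \<open>a\<close> and 0
  for \<open>b\<close>. Below distance \<open>k / 2\<close>, matched lengths change by less than
  \<open>k\<close>, which is too little to match the raised point.\<close>

lemma eh_dist_profile_ge:
  assumes len: "length a = k" "length b = k" and j0: "j0 < N"
    and a: "\<And>i. i < k \<Longrightarrow> a ! i \<le> j0" and b: "\<And>i. i < k \<Longrightarrow> j0 < b ! i"
  shows "real k / 2 \<le> eh_dist (profile k N a) (profile k N b)"
proof (rule ccontr)
  define M W where "M = 4 * real k + 4" and "W = M * real N"
  let ?X = "profile k N a" and ?Y = "profile k N b"
  assume "\<not> ?thesis"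
  then have "eh_dist ?X ?Y < real k / 2" by simp
  then obtain R where R: "correspondence ?X ?Y R" and
    dis0: "\<And>x y x' y'. (x, y) \<in> R \<Longrightarrow> (x', y') \<in> R \<Longrightarrow> \<bar>\<bar>x - x'\<bar> - \<bar>y - y'\<bar>\<bar> < 2 * (real k / 2)"
    using eh_dist_less_distortion[OF finite_profile finite_profile] by metis
  then have dis: "\<And>x y x' y'. (x, y) \<in> R \<Longrightarrow> (x', y') \<in> R \<Longrightarrow> \<bar>\<bar>x - x'\<bar> - \<bar>y - y'\<bar>\<bar> < real k" by simp
  have "M * 1 \<le> M * real N" using j0 by (intro mult_left_mono) (auto simp: M_def)
  then have W: "4 * real k + 4 \<le> W" by (simp add: W_def M_def)
  have Ycases: "y = - 2 * W \<or> y = W \<or> (\<exists>j<N. y = M * real j + real (height b j) \<and> 0 \<le> y \<and> y + 3 * real k + 4 \<le> W)"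
    if "y \<in> ?Y" for y
  proof -
    from that consider "y = - 2 * W" | "y = W" | j where "j < N" "y = M * real j + real (height b j)"
      unfolding profile_def W_def M_def by blast
    then show ?thesis
    proof cases
      case (3 j)
      then show ?thesis using profile_inner[OF len(2) 3(1)] by (auto simp: W_def M_def)
    qed auto
  qed
  define p where "p = M * real j0 + real k"
  have h: "height a j0 = k" "height b j0 = 0" using height_full[of a j0] height_zero[of b j0] a b len by auto
  have "- 2 * W \<in> ?X" "W \<in> ?X" "p \<in> ?X"
    using j0 h by (auto simp: profile_def W_def M_def p_def image_iff)
  then obtain y1 y2 y where Ry: "(- 2 * W, y1) \<in> R" "(W, y2) \<in> R" "(p, y) \<in> R"
    and Y: "y1 \<in> ?Y" "y2 \<in> ?Y" "y \<in> ?Y"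
    using R unfolding correspondence_def by meson
  have p: "0 \<le> p" "p + 3 * real k + 4 \<le> W"
    using profile_inner[OF len(1) j0] h by (auto simp: p_def W_def M_def)
  have d12: "\<bar>\<bar>- 2 * W - W\<bar> - \<bar>y1 - y2\<bar>\<bar> < real k" by (rule dis[OF Ry(1,2)])
  have d13: "\<bar>\<bar>- 2 * W - p\<bar> - \<bar>y1 - y\<bar>\<bar> < real k" by (rule dis[OF Ry(1,3)])
  \<comment> \<open>The ends of \<open>?X\<close> are \<open>3 * W\<close> apart; in
    \<open>?Y\<close> only the two ends are that far apart up to an error \<open>k\<close>.\<close>
  have "y1 = - 2 * W \<or> y1 = W"
    using Ycases[OF Y(1)] Ycases[OF Y(2)] d12 W by (elim disjE exE conjE; linarith)
  then show False
  proof
    assume y1: "y1 = - 2 * W"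
    from Ycases[OF Y(3)] show False
    proof (elim disjE exE conjE)
      fix j assume j: "y = M * real j + real (height b j)" "0 \<le> y"
      \<comment> \<open>With the left ends matched, positions are nearly preserved. The point of
        \<open>?Y\<close> at \<open>j0\<close> is exactly \<open>k\<close> away from
        \<open>p\<close>, and the other inner points are farther.\<close>
      then have near: "\<bar>p - y\<bar> < real k" using d13 y1 p W by linarith
      have hj: "real (height b j) \<le> real k" using height_le[of b j] len by simp
      consider "j = j0" | "j < j0" | "j0 < j" by linarith
      then show False
      proof cases
        case 1
        then show False using near j h by (simp add: p_def)
      next
        case 2
        then have "M * (real j + 1) \<le> M * real j0" by (intro mult_left_mono) (auto simp: M_def)
        then have "M * real j + M \<le> M * real j0" by (simp add: algebra_simps)
        then show False using near j hj by (simp add: p_def M_def)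
      next
        case 3
        then have "M * (real j0 + 1) \<le> M * real j" by (intro mult_left_mono) (auto simp: M_def)
        then have "M * real j0 + M \<le> M * real j" by (simp add: algebra_simps)
        then show False using near j hj by (simp add: p_def M_def)
      qed
    qed (use d13 y1 p W in linarith)+
  next
    \<comment> \<open>This is the reflected case: \<open>p\<close> is at distance
      \<open>2 * W + p\<close> from the left end, but from \<open>W\<close> the points of
      \<open>?Y\<close> are at distance at most \<open>W\<close> or exactly
      \<open>3 * W\<close>.\<close>
    assume y1: "y1 = W"
    from Ycases[OF Y(3)] show False
      using d13 y1 p W by (elim disjE exE conjE; linarith)
  qed
qed

section \<open>Far sets with close images, and the contradiction\<close>

text \<open>The sets are profiles of tuples \<open>a\<close>, \<open>b\<close> with \<open>a\<close>
  wholly to the left of \<open>b\<close>. The value of \<rho> at \<open>k\<close> serves only to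
  bound \<open>f\<close>; the final estimate involves \<rho> at 1 alone.\<close>

lemma far_sets_with_close_images:
  fixes \<phi> :: "real set \<Rightarrow> 'a::real_normed_vector"
  assumes uc: "uniformly_convex TYPE('a)"
    and \<rho>: "\<And>X Y. finite X \<Longrightarrow> X \<noteq> {} \<Longrightarrow> finite Y \<Longrightarrow> Y \<noteq> {} \<Longrightarrow>
      dist (\<phi> X) (\<phi> Y) \<le> \<rho> (eh_dist X Y)"
    and pos: "\<And>t. 0 \<le> t \<Longrightarrow> 0 \<le> \<rho> t"
  shows "\<exists>X Y. finite X \<and> X \<noteq> {} \<and> finite Y \<and> Y \<noteq> {} \<and> D \<le> eh_dist X Y \<and>
    dist (\<phi> X) (\<phi> Y) \<le> 4 * \<rho> 1 + 2"
proof -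
  define L where "L = 2 * \<rho> 1"
  obtain k :: nat where "2 * D \<le> real k" using real_arch_simple by blast
  then have k: "D \<le> real k / 2" by simp
  define \<Theta> where "\<Theta> N n = \<phi> (profile k N n)" for N n
  \<comment> \<open>Subtracting a base value bounds \<open>f\<close> uniformly in \<open>N\<close>
    without changing differences; lists of other lengths get 0 so that the bound holds for all
    lists.\<close>
  define f where "f n N = (if length n = k then \<Theta> N n - \<Theta> N (replicate k 0) else 0)" for n N
  obtain G :: "nat filter" where G: "G \<noteq> bot" "G \<le> sequentially"
    "\<And>r :: nat \<Rightarrow> real. bounded (range r) \<Longrightarrow> \<exists>l. (r \<longlongrightarrow> l) G"
    using ex_limit_filter by blast
  have f_bound: "norm (f n N) \<le> 2 * \<rho> (real k)" for n N
  proof (cases "length n = k")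
    case True
    have "dist (\<Theta> N n) (\<Theta> N (replicate k 0)) \<le> 2 * \<rho> (real k)"
      unfolding \<Theta>_def
    proof (rule dist_image_profile_le[where \<rho> = \<rho> and \<phi> = \<phi>])
      show "\<bar>real (height n j) - real (height (replicate k 0) j)\<bar> \<le> real k" for j
        using height_le[of n j] height_le[of "replicate k 0" j] True by simp
    qed (use True in \<open>auto intro: \<rho>\<close>)
    then show ?thesis using True by (simp add: f_def dist_norm)
  qed (use pos in \<open>simp add: f_def\<close>)
  have "\<exists>x. \<forall>m. \<exists>c. c 0 = m \<and> (\<forall>i<k. c i \<le> c (Suc i)) \<and>
     (\<forall>\<^sub>F N in G. \<forall>z r. (\<forall>n\<in>interlacing k c. norm (f n N - z) \<le> r) \<longrightarrow> norm (x N - z) \<le> r + 1)"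
    by (rule uniformly_convex_interlacing_limit[OF uc G(1)]) (use G(3) f_bound in auto)
  then obtain x where x: "\<And>m. \<exists>c. c 0 = m \<and> (\<forall>i<k. c i \<le> c (Suc i)) \<and>
     (\<forall>\<^sub>F N in G. \<forall>z r. (\<forall>n\<in>interlacing k c. norm (f n N - z) \<le> r) \<longrightarrow> norm (x N - z) \<le> r + 1)"
    by blast
  obtain c where c: "\<And>i. i < k \<Longrightarrow> c i \<le> c (Suc i)" and
    xc: "\<forall>\<^sub>F N in G. \<forall>z r. (\<forall>n\<in>interlacing k c. norm (f n N - z) \<le> r) \<longrightarrow> norm (x N - z) \<le> r + 1"
    using x[of 0] by blast
  \<comment> \<open>The second tuple starts beyond \<open>c k\<close>, yet has the same limit
    \<open>x\<close>.\<close>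
  obtain d where d: "d 0 = Suc (c k)" "\<And>i. i < k \<Longrightarrow> d i \<le> d (Suc i)" and
    xd: "\<forall>\<^sub>F N in G. \<forall>z r. (\<forall>n\<in>interlacing k d. norm (f n N - z) \<le> r) \<longrightarrow> norm (x N - z) \<le> r + 1"
    using x[of "Suc (c k)"] by blast
  \<comment> \<open>The separating position \<open>j0 = c k\<close> must be recorded in the
    profiles.\<close>
  have "\<forall>\<^sub>F N in G. c k < N" using G(2) eventually_gt_at_top[of "c k"] by (rule filter_leD)
  then obtain N where N: "c k < N"
    and xcN: "\<And>z r. \<forall>n\<in>interlacing k c. norm (f n N - z) \<le> r \<Longrightarrow> norm (x N - z) \<le> r + 1"
    and xdN: "\<And>z r. \<forall>n\<in>interlacing k d. norm (f n N - z) \<le> r \<Longrightarrow> norm (x N - z) \<le> r + 1"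
    using eventually_happens'[OF G(1) eventually_conj[OF _ eventually_conj[OF xc xd]]] by blast
  define a b where "a = map c [0..<k]" and "b = map d [0..<k]"
  have near: "norm (f n N - f (map e [0..<k]) N) \<le> L" if "n \<in> interlacing k e" for n e
  proof -
    have len: "length n = k" using that by (simp add: interlacing_def)
    have "dist (\<Theta> N (map e [0..<k])) (\<Theta> N n) \<le> 2 * \<rho> 1"
      unfolding \<Theta>_def by (intro dist_image_profile_le[where \<rho> = \<rho> and \<phi> = \<phi>]
        height_interlacing that \<rho>) (auto simp: len)
    then show ?thesis using len by (simp add: f_def L_def dist_norm norm_minus_commute)
  qed
  \<comment> \<open>Apply the hull clause with \<open>f a N\<close>, respectively
    \<open>f b N\<close>, as centre and \<open>L\<close> as radius.\<close>
  have "norm (x N - f a N) \<le> L + 1" "norm (x N - f b N) \<le> L + 1"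
    unfolding a_def b_def using near by (blast intro: xcN xdN)+
  then have "norm (f a N - f b N) \<le> 2 * L + 2"
    using norm_triangle_ineq4[of "x N - f b N" "x N - f a N"] by (simp add: algebra_simps)
  then have "dist (\<Theta> N a) (\<Theta> N b) \<le> 2 * L + 2" by (simp add: f_def a_def b_def dist_norm)
  moreover have "c i \<le> c k" if "i \<le> k" for i
    using that by (induction rule: inc_induct) (use c in \<open>auto intro: order_trans\<close>)
  moreover have "d 0 \<le> d i" if "i < k" for i
    using that by (induction i) (use d in \<open>auto intro: order_trans\<close>)
  ultimately have "real k / 2 \<le> eh_dist (profile k N a) (profile k N b)"
    using d(1) N by (intro eh_dist_profile_ge[of _ _ _ "c k"]) (auto simp: a_def b_def Suc_le_eq)
  then show ?thesis
    using \<open>dist (\<Theta> N a) (\<Theta> N b) \<le> 2 * L + 2\<close> k finite_profile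
    by (intro exI[of _ "profile k N a"] exI[of _ "profile k N b"]) (simp add: \<Theta>_def L_def)
qed

theorem theorem4p2:
  assumes "uniformly_convex TYPE('a::banach)"
  shows "\<not> (\<exists>\<psi> :: eh1 \<Rightarrow> 'a. coarse_embedding \<psi>)"
proof
  assume "\<exists>\<psi> :: eh1 \<Rightarrow> 'a. coarse_embedding \<psi>"
  then obtain \<psi> :: "eh1 \<Rightarrow> 'a" and \<rho>1 \<rho>2 :: "real \<Rightarrow> real" where
    lim: "filterlim \<rho>1 at_top at_top" and
    lower: "\<And>x y. \<rho>1 (dist x y) \<le> dist (\<psi> x) (\<psi> y)" and
    upper: "\<And>x y. dist (\<psi> x) (\<psi> y) \<le> \<rho>2 (dist x y)" and
    pos: "\<And>t. 0 \<le> t \<Longrightarrow> 0 \<le> \<rho>2 t"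
    unfolding coarse_embedding_def by blast
  have dist_abs: "dist (abs_eh1 X) (abs_eh1 Y) = eh_dist X Y"
    if "finite X" "X \<noteq> {}" "finite Y" "Y \<noteq> {}" for X Y
    using that by (intro dist_eh1.abs_eq) (auto simp: fin_isometric_def isometric_refl)
  \<comment> \<open>The lower control then exceeds the bound \<open>4 * \<rho>2 1 + 2\<close> for
    the close images.\<close>
  obtain T where T: "\<And>t. T \<le> t \<Longrightarrow> 4 * \<rho>2 1 + 3 \<le> \<rho>1 t"
    using lim unfolding filterlim_at_top eventually_at_top_linorder by blast
  have "dist (\<psi> (abs_eh1 X)) (\<psi> (abs_eh1 Y)) \<le> \<rho>2 (eh_dist X Y)"
    if "finite X" "X \<noteq> {}" "finite Y" "Y \<noteq> {}" for X Y
    using upper[of "abs_eh1 X" "abs_eh1 Y"] dist_abs[OF that] by simp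
  then obtain X Y where XY: "finite X" "X \<noteq> {}" "finite Y" "Y \<noteq> {}" "T \<le> eh_dist X Y"
    "dist (\<psi> (abs_eh1 X)) (\<psi> (abs_eh1 Y)) \<le> 4 * \<rho>2 1 + 2"
    using far_sets_with_close_images[where \<phi> = "\<lambda>X. \<psi> (abs_eh1 X)" and \<rho> = \<rho>2 and D = T,
        OF assms _ pos] by blast
  have "4 * \<rho>2 1 + 3 \<le> \<rho>1 (dist (abs_eh1 X) (abs_eh1 Y))"
    using T XY dist_abs by simp
  then show False using lower[of "abs_eh1 X" "abs_eh1 Y"] XY(6) by linarith
qed

end
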